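(* Let $n\ge1$, and for $0\le k\le n$ let $l_{n,k}$ denote the number of elements $\alpha\in\mathcal{IS}_n$ for which the orbit of $1$ under $\alpha$ has length $k$. Then: (i) $l_{n,0}=|T_n|$; (ii) $l_{n,1}=|\mathcal{IS}_{n-1}|$; (iii) $l_{n,k}=[n-1]_{k-1}\,\bigl(L_{n-k}+2|\mathcal{IS}_{n-k}|\bigr)$ for $1<k\le n$.
   Context: For $m\ge0$ let $\mathcal{IS}_m$ be the symmetric inverse semigroup of all partial injective maps from $\{1,\dots,m\}$ to itself (bijections between subsets $\operatorname{dom}(\alpha)$ and $\operatorname{im}(\alpha)$; the empty map, denoted $0$, is the zero element), under composition of partial maps; $\mathcal{IS}_0=\{0\}$ has one element. $T_m\subseteq\mathcal{IS}_m$ is the set of nilpotent elements, i.e. those $\alpha$ with $\alpha^r=0$ for some $r>0$. The graph of the action of $\alpha$ has an arrow $x\to\alpha(x)$ for each $x\in\operatorname{dom}(\alpha)$; each connected component is either a directed cycle or a directed path $a_1\to\dots\to a_k$, $k\ge1$, with $a_1\notin\operatorname{im}(\alpha)$, $a_k\notin\operatorname{dom}(\alpha)$ (a "chain"; a chain of length 1 is a point outside $\operatorname{dom}(\alpha)\cup\operatorname{im}(\alpha)$). $L_m$ is the total number of chains in the chain decompositions of all elements of $\mathcal{IS}_m$; $L_0=0$. If $x\in\operatorname{dom}(\alpha)$, the orbit of $x$ under $\alpha$ is $\{x,\alpha(x),\alpha^2(x),\dots\}$ (of those iterates that are defined) and its length is its cardinality; if $x\notin\operatorname{dom}(\alpha)$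 the orbit is empty and has length $0$. $[x]_k=x(x-1)\cdots(x-k+1)$ is the decreasing factorial, $[x]_0=1$. *)

theory Defs
  imports Main
begin

definition sym_inv :: "nat \<Rightarrow> (nat \<rightharpoonup> nat) set" where
  "sym_inv m = {\<alpha>. dom \<alpha> \<subseteq> {1..m} \<and> ran \<alpha> \<subseteq> {1..m} \<and> inj_on \<alpha> (dom \<alpha>)}"

text \<open>The zeroth power is the identity on the whole type rather than on
  \<open>{1..m}\<close>; positive powers do not see the difference.\<close>

primrec ppow :: "('a \<rightharpoonup> 'a) \<Rightarrow> nat \<Rightarrow> ('a \<rightharpoonup> 'a)" where
  "ppow \<alpha> 0 = Some"
| "ppow \<alpha> (Suc r) = \<alpha> \<circ>\<^sub>m ppow \<alpha> r"

definition nilpotents :: "nat \<Rightarrow> (nat \<rightharpoonup> nat) set" where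
  "nilpotents m = {\<alpha> \<in> sym_inv m. \<exists>r>0. ppow \<alpha> r = Map.empty}"

definition arrows :: "('a \<rightharpoonup> 'a) \<Rightarrow> 'a rel" where
  "arrows \<alpha> = {(x, y). \<alpha> x = Some y}"

definition components :: "nat \<Rightarrow> (nat \<rightharpoonup> nat) \<Rightarrow> nat set set" where
  "components m \<alpha> = {1..m} // ((arrows \<alpha> \<union> (arrows \<alpha>)\<inverse>)\<^sup>*)"

text \<open>A chain is represented by the vertex set of the component; the list gives its
  vertices in the order of the directed path.\<close>

definition chains :: "nat \<Rightarrow> (nat \<rightharpoonup> nat) \<Rightarrow> nat set set" where
  "chains m \<alpha> = {C \<in> components m \<alpha>.
     \<exists>as. as \<noteq> [] \<and> distinct as \<and> set as = C \<and>
       (\<forall>i. Suc i < length as \<longrightarrow> (as ! i, as ! Suc i) \<in> arrows \<alpha>) \<and>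
       hd as \<notin> ran \<alpha> \<and> last as \<notin> dom \<alpha>}"

definition total_chains :: "nat \<Rightarrow> nat" where
  "total_chains m = (\<Sum>\<alpha>\<in>sym_inv m. card (chains m \<alpha>))"

definition porbit :: "('a \<rightharpoonup> 'a) \<Rightarrow> 'a \<Rightarrow> 'a set" where
  "porbit \<alpha> x = (if x \<in> dom \<alpha> then {y. \<exists>i. ppow \<alpha> i x = Some y} else {})"

definition orbit_count :: "nat \<Rightarrow> nat \<Rightarrow> nat" where
  "orbit_count n k = card {\<alpha> \<in> sym_inv n. card (porbit \<alpha> 1) = k}"

definition falling_fact :: "'a::comm_ring_1 \<Rightarrow> nat \<Rightarrow> 'a" where
  "falling_fact x k = (\<Prod>i<k. x - of_nat i)"

end

theory Submission
  imports Defs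
begin

text \<open>
  Let \<open>N(d, r)\<close> be the number of partial injections from a \<open>d\<close>-element set to an \<open>r\<close>-element
  set. All counts in the theorem reduce to values of \<open>N\<close>, for one reason: the partial injections
  from \<open>D\<close> to \<open>R\<close> that extend a given one, \<open>\<beta>\<close>, correspond to the partial injections from
  \<open>D - dom \<beta>\<close> to \<open>R - ran \<beta>\<close> (\<open>card_pinj_extending\<close>). Two consequences are the recursion
  \<open>N(d + 1, r) = N(d, r) + r N(d, r - 1)\<close> and, since a partial injection may be inverted, the
  symmetry \<open>N(d, r) = N(r, d)\<close>.

  The chains of a map are in bijection with their last points, the points outside its domain.
  Hence \<open>L\<^sub>m\<close> counts pairs of a map and a point where it is undefined, so
  \<open>L\<^sub>m = m N(m - 1, m)\<close>, and the recursion turns \<open>L\<^sub>m + N(m, m)\<close> into \<open>N(m, m + 1)\<close>.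

  Orbit length 0 means that 1 is outside the domain, which leaves \<open>N(n - 1, n)\<close> maps. A map is
  nilpotent iff its graph has no cycle. A nilpotent map is built by defining it at one point \<open>x\<close> of
  its domain after another; the values forbidden at \<open>x\<close> are those already taken and the starting
  point of the chain that currently ends in \<open>x\<close>. With \<open>i\<close> points already treated, \<open>n - 1 - i\<close>
  choices remain, the same number as for a partial injection into a set of size \<open>n - 1\<close>
  (\<open>card_nilpotents\<close>). So there are \<open>N(n, n - 1) = N(n - 1, n)\<close> nilpotent maps. Orbit length 1
  means that 1 is a fixed point, which leaves \<open>N(n - 1, n - 1)\<close> maps.

  For orbit length \<open>k > 1\<close>, choose the points that follow 1 in its orbit, in one of
  \<open>[n - 1]\<^sub>k\<^sub>-\<^sub>1\<close> ways. The last of them either is sent back to 1, which leaves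
  \<open>N(n - k, n - k)\<close> maps on the other points, or is outside the domain; then the other points
  are mapped into themselves and 1, in \<open>N(n - k, n - k + 1) = L\<^sub>n\<^sub>-\<^sub>k + N(n - k, n - k)\<close> ways
  (\<open>card_extending_full_path\<close>, \<open>card_extending_path\<close>).
\<close>

section \<open>Partial injections between two sets\<close>

definition pinj :: "'a set \<Rightarrow> 'b set \<Rightarrow> ('a \<rightharpoonup> 'b) set" where
  "pinj D R = {\<alpha>. dom \<alpha> \<subseteq> D \<and> ran \<alpha> \<subseteq> R \<and> inj_on \<alpha> (dom \<alpha>)}"

lemma sym_inv_eq_pinj: "sym_inv m = pinj {1..m} {1..m}"
  by (simp add: sym_inv_def pinj_def)

lemma inj_on_dom_iff:
  "inj_on \<alpha> (dom \<alpha>) \<longleftrightarrow> (\<forall>x y z. \<alpha> x = Some z \<longrightarrow> \<alpha> y = Some z \<longrightarrow> x = y)"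
  by (auto simp: inj_on_def dom_def)

lemma pinj_iff:
  "\<alpha> \<in> pinj D R \<longleftrightarrow> (\<forall>x z. \<alpha> x = Some z \<longrightarrow> x \<in> D \<and> z \<in> R)
     \<and> (\<forall>x y z. \<alpha> x = Some z \<longrightarrow> \<alpha> y = Some z \<longrightarrow> x = y)"
  unfolding pinj_def inj_on_dom_iff by (auto simp: dom_def ran_def subset_iff)

lemma pinjI:
  assumes "\<And>x z. \<alpha> x = Some z \<Longrightarrow> x \<in> D \<and> z \<in> R"
    and "\<And>x y z. \<alpha> x = Some z \<Longrightarrow> \<alpha> y = Some z \<Longrightarrow> x = y"
  shows "\<alpha> \<in> pinj D R"
  using assms unfolding pinj_iff by blast

lemma pinjD:
  assumes "\<alpha> \<in> pinj D R" "\<alpha> x = Some z"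
  shows "x \<in> D" "z \<in> R" "\<alpha> y = Some z \<Longrightarrow> y = x"
  using assms unfolding pinj_iff by blast+

lemma fun_upd_in_pinj_iff:
  assumes "\<alpha> \<in> pinj D R" "x \<notin> dom \<alpha>"
  shows "\<alpha>(x \<mapsto> y) \<in> pinj D R \<longleftrightarrow> x \<in> D \<and> y \<in> R - ran \<alpha>"
proof
  assume mem: "\<alpha>(x \<mapsto> y) \<in> pinj D R"
  have "x \<in> D \<and> y \<in> R" using pinjD(1,2)[OF mem, of x] by simp
  moreover have "y \<notin> ran \<alpha>"
  proof
    assume "y \<in> ran \<alpha>"
    then obtain w where w: "\<alpha> w = Some y" by (auto simp: ran_def)
    then have "w \<noteq> x" using assms by auto
    then show False using pinjD(3)[OF mem, of x y w] w by simp
  qed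
  ultimately show "x \<in> D \<and> y \<in> R - ran \<alpha>" by simp
next
  assume y: "x \<in> D \<and> y \<in> R - ran \<alpha>"
  show "\<alpha>(x \<mapsto> y) \<in> pinj D R"
  proof (rule pinjI)
    fix u z assume "(\<alpha>(x \<mapsto> y)) u = Some z"
    then show "u \<in> D \<and> z \<in> R"
      using y pinjD(1,2)[OF assms(1), of u z] by (auto split: if_splits)
  next
    fix u v z assume "(\<alpha>(x \<mapsto> y)) u = Some z" "(\<alpha>(x \<mapsto> y)) v = Some z"
    then show "u = v"
      using y pinjD(3)[OF assms(1), of u z v] by (auto simp: ranI split: if_splits)
  qed
qed

lemma restrict_map_in_pinj: "\<alpha> \<in> pinj D R \<Longrightarrow> \<alpha> |` X \<in> pinj D R"
  by (auto intro!: pinjI dest: pinjD simp: restrict_map_def split: if_splits)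

lemma card_ran_pinj:
  assumes "\<alpha> \<in> pinj D R"
  shows "card (ran \<alpha>) = card (dom \<alpha>)"
proof -
  have "ran \<alpha> = (\<lambda>u. the (\<alpha> u)) ` dom \<alpha>"
    by (force simp: ran_def dom_def image_iff)
  moreover have "inj_on (\<lambda>u. the (\<alpha> u)) (dom \<alpha>)"
    using pinjD(3)[OF assms] by (auto simp: inj_on_def)
  ultimately show ?thesis by (simp add: card_image)
qed

lemma finite_pinj:
  assumes "finite D" "finite R"
  shows "finite (pinj D R)"
proof (rule finite_subset)
  show "pinj D R \<subseteq> (\<Union>E\<in>Pow D. {\<alpha>. dom \<alpha> = E \<and> ran \<alpha> \<subseteq> R})"
    by (auto simp: pinj_def)
  show "finite (\<Union>E\<in>Pow D. {\<alpha>. dom \<alpha> = E \<and> ran \<alpha> \<subseteq> R})"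
    using assms by (auto intro!: finite_set_of_finite_maps finite_subset[of _ D])
qed

text \<open>Injectivity keeps the rest of an extension of \<open>\<beta>\<close> away from the range of \<open>\<beta>\<close>, so cutting
  \<open>\<beta>\<close> off and putting it back are inverse operations.\<close>

lemma card_pinj_extending:
  assumes "\<beta> \<in> pinj D R"
  shows "card {\<alpha> \<in> pinj D R. \<beta> \<subseteq>\<^sub>m \<alpha>} = card (pinj (D - dom \<beta>) (R - ran \<beta>))"
proof -
  have sub: "\<beta> \<subseteq>\<^sub>m \<alpha> \<longleftrightarrow> (\<forall>x z. \<beta> x = Some z \<longrightarrow> \<alpha> x = Some z)" for \<alpha> :: "'a \<rightharpoonup> 'b"
    by (auto simp: map_le_def dom_def)
  have "bij_betw (\<lambda>\<alpha>. \<alpha> |` (- dom \<beta>)) {\<alpha> \<in> pinj D R. \<beta> \<subseteq>\<^sub>m \<alpha>} (pinj (D - dom \<beta>) (R - ran \<beta>))"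
  proof (rule bij_betw_byWitness[where f' = "\<lambda>\<alpha>. \<alpha> ++ \<beta>"])
    show "\<forall>\<alpha>\<in>{\<alpha> \<in> pinj D R. \<beta> \<subseteq>\<^sub>m \<alpha>}. \<alpha> |` (- dom \<beta>) ++ \<beta> = \<alpha>"
      by (auto simp: sub map_add_def restrict_map_def fun_eq_iff split: option.split)
    show "\<forall>\<alpha>\<in>pinj (D - dom \<beta>) (R - ran \<beta>). (\<alpha> ++ \<beta>) |` (- dom \<beta>) = \<alpha>"
    proof
      fix \<alpha> assume "\<alpha> \<in> pinj (D - dom \<beta>) (R - ran \<beta>)"
      from pinjD(1)[OF this] have "\<alpha> x = None" if "x \<in> dom \<beta>" for x
        using that by (cases "\<alpha> x") blast+
      then show "(\<alpha> ++ \<beta>) |` (- dom \<beta>) = \<alpha>"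
        by (auto simp: map_add_def restrict_map_def fun_eq_iff split: option.split)
    qed
    show "(\<lambda>\<alpha>. \<alpha> |` (- dom \<beta>)) ` {\<alpha> \<in> pinj D R. \<beta> \<subseteq>\<^sub>m \<alpha>} \<subseteq> pinj (D - dom \<beta>) (R - ran \<beta>)"
    proof clarify
      fix \<alpha> assume \<alpha>: "\<alpha> \<in> pinj D R" and le: "\<beta> \<subseteq>\<^sub>m \<alpha>"
      show "\<alpha> |` (- dom \<beta>) \<in> pinj (D - dom \<beta>) (R - ran \<beta>)"
      proof (rule pinjI)
        fix x z assume "(\<alpha> |` (- dom \<beta>)) x = Some z"
        then have x: "\<alpha> x = Some z" "x \<notin> dom \<beta>" by (auto simp: restrict_map_def split: if_splits)
        have "z \<notin> ran \<beta>"
        proof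
          assume "z \<in> ran \<beta>"
          then obtain w where "\<beta> w = Some z" by (auto simp: ran_def)
          with le have "\<alpha> w = Some z" by (auto simp: sub)
          with pinjD(3)[OF \<alpha> x(1)] have "w = x" by blast
          with x \<open>\<beta> w = Some z\<close> show False by auto
        qed
        then show "x \<in> D - dom \<beta> \<and> z \<in> R - ran \<beta>" using x pinjD[OF \<alpha> x(1)] by blast
      next
        fix x y z assume "(\<alpha> |` (- dom \<beta>)) x = Some z" "(\<alpha> |` (- dom \<beta>)) y = Some z"
        then show "x = y" using pinjD(3)[OF \<alpha>] by (auto simp: restrict_map_def split: if_splits)
      qed
    qed
    show "(\<lambda>\<alpha>. \<alpha> ++ \<beta>) ` pinj (D - dom \<beta>) (R - ran \<beta>) \<subseteq> {\<alpha> \<in> pinj D R. \<beta> \<subseteq>\<^sub>m \<alpha>}"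
    proof clarify
      fix \<alpha> assume \<alpha>: "\<alpha> \<in> pinj (D - dom \<beta>) (R - ran \<beta>)"
      have "\<alpha> ++ \<beta> \<in> pinj D R"
      proof (rule pinjI)
        fix x z assume "(\<alpha> ++ \<beta>) x = Some z"
        then show "x \<in> D \<and> z \<in> R"
          using pinjD[OF \<alpha>] pinjD[OF assms] by (auto simp: map_add_Some_iff)
      next
        fix x y z assume "(\<alpha> ++ \<beta>) x = Some z" "(\<alpha> ++ \<beta>) y = Some z"
        moreover have "\<not> (\<alpha> u = Some z \<and> \<beta> v = Some z)" for u v
          using pinjD(2)[OF \<alpha>, of u z] by (auto simp: ran_def)
        ultimately show "x = y"
          using pinjD(3)[OF \<alpha>, of x z y] pinjD(3)[OF assms, of x z y]
          unfolding map_add_Some_iff by blast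
      qed
      then show "\<alpha> ++ \<beta> \<in> pinj D R \<and> \<beta> \<subseteq>\<^sub>m \<alpha> ++ \<beta>" by simp
    qed
  qed
  then show ?thesis by (rule bij_betw_same_card)
qed

lemma card_pinj_fixing:
  assumes "x \<in> D" "y \<in> R"
  shows "card {\<alpha> \<in> pinj D R. \<alpha> x = Some y} = card (pinj (D - {x}) (R - {y}))"
proof -
  have "[x \<mapsto> y] \<in> pinj D R"
    using assms by (intro pinjI) (auto split: if_splits)
  moreover have "[x \<mapsto> y] \<subseteq>\<^sub>m \<alpha> \<longleftrightarrow> \<alpha> x = Some y" for \<alpha> :: "'a \<rightharpoonup> 'b"
    by (auto simp: map_le_def)
  ultimately show ?thesis
    using card_pinj_extending[of "[x \<mapsto> y]" D R] by simp
qed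

lemma pinj_undefined_at: "{\<alpha> \<in> pinj D R. \<alpha> x = None} = pinj (D - {x}) R"
  by (auto simp: pinj_def dom_def)

text \<open>Either the new point is outside the domain, or its value is one of the points \<open>y\<close>.\<close>

lemma card_pinj_insert:
  assumes "finite D" "finite R" "x \<notin> D"
  shows "card (pinj (insert x D) R) = card (pinj D R) + (\<Sum>y\<in>R. card (pinj D (R - {y})))"
proof -
  let ?P = "pinj (insert x D) R"
  have fin: "finite ?P" using assms by (simp add: finite_pinj)
  have split: "?P = {\<alpha> \<in> ?P. \<alpha> x = None} \<union> (\<Union>y\<in>R. {\<alpha> \<in> ?P. \<alpha> x = Some y})"
  proof (intro equalityI subsetI)
    fix \<alpha> assume \<alpha>: "\<alpha> \<in> ?P"
    show "\<alpha> \<in> {\<alpha> \<in> ?P. \<alpha> x = None} \<union> (\<Union>y\<in>R. {\<alpha> \<in> ?P. \<alpha> x = Some y})"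
    proof (cases "\<alpha> x")
      case None
      then show ?thesis using \<alpha> by simp
    next
      case (Some y)
      then show ?thesis using \<alpha> pinjD(2)[OF \<alpha> Some] by simp
    qed
  qed auto
  have "card ?P = card {\<alpha> \<in> ?P. \<alpha> x = None} + card (\<Union>y\<in>R. {\<alpha> \<in> ?P. \<alpha> x = Some y})"
    by (subst split, rule card_Un_disjoint) (use fin assms in auto)
  also have "card (\<Union>y\<in>R. {\<alpha> \<in> ?P. \<alpha> x = Some y}) = (\<Sum>y\<in>R. card {\<alpha> \<in> ?P. \<alpha> x = Some y})"
    by (rule card_UN_disjoint) (use fin assms in auto)
  also have "\<dots> = (\<Sum>y\<in>R. card (pinj D (R - {y})))"
    using assms by (intro sum.cong) (auto simp: card_pinj_fixing)
  finally show ?thesis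
    using assms by (simp add: pinj_undefined_at)
qed

text \<open>This is the number of ways to place any number of non-attacking rooks on a \<open>d\<close> by \<open>r\<close>
  board: a partial injection is such a placement, and the recursion decides on the rook in one
  row.\<close>

fun rook_placements :: "nat \<Rightarrow> nat \<Rightarrow> nat" where
  "rook_placements 0 r = 1"
| "rook_placements (Suc d) r = rook_placements d r + r * rook_placements d (r - 1)"

lemma card_pinj:
  fixes D :: "'a set"
  assumes "finite D" "finite R"
  shows "card (pinj D R) = rook_placements (card D) (card R)"
  using assms
proof (induction D arbitrary: R rule: finite_induct)
  case empty
  have "pinj ({} :: 'a set) R = {Map.empty}"
    by (auto simp: pinj_def)
  then show ?case by simp
next
  case (insert x D)
  then have "(\<Sum>y\<in>R. card (pinj D (R - {y}))) = (\<Sum>y\<in>R. rook_placements (card D) (card R - 1))"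
    by (intro sum.cong) auto
  then show ?case
    using insert by (simp add: card_pinj_insert)
qed

definition inverse_map :: "('a \<rightharpoonup> 'b) \<Rightarrow> ('b \<rightharpoonup> 'a)" where
  "inverse_map \<alpha> y = (if \<exists>x. \<alpha> x = Some y then Some (SOME x. \<alpha> x = Some y) else None)"

lemma inverse_map_Some_iff:
  assumes "\<alpha> \<in> pinj D R"
  shows "inverse_map \<alpha> y = Some x \<longleftrightarrow> \<alpha> x = Some y"
proof -
  have "(SOME x'. \<alpha> x' = Some y) = x" if "\<alpha> x = Some y" for x
    using that pinjD(3)[OF assms] by (intro some_equality) auto
  then show ?thesis
    unfolding inverse_map_def by auto
qed

lemma inverse_map_in_pinj: "\<alpha> \<in> pinj D R \<Longrightarrow> inverse_map \<alpha> \<in> pinj R D"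
  by (rule pinjI) (auto simp: inverse_map_Some_iff dest: pinjD)

lemma inverse_map_inverse_map:
  assumes "\<alpha> \<in> pinj D R"
  shows "inverse_map (inverse_map \<alpha>) = \<alpha>"
proof
  fix x
  have "inverse_map (inverse_map \<alpha>) x = Some y \<longleftrightarrow> \<alpha> x = Some y" for y
    using assms inverse_map_in_pinj[OF assms] by (simp add: inverse_map_Some_iff)
  then show "inverse_map (inverse_map \<alpha>) x = \<alpha> x"
    by (metis option.exhaust)
qed

lemma card_pinj_commute: "card (pinj D R) = card (pinj R D)"
proof (rule bij_betw_same_card)
  show "bij_betw inverse_map (pinj D R) (pinj R D)"
    by (rule bij_betw_byWitness[where f' = inverse_map])
       (auto simp: inverse_map_inverse_map inverse_map_in_pinj)
qed

lemma rook_placements_commute: "rook_placements d r = rook_placements r d"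
  using card_pinj_commute[of "{..<d}" "{..<r}"] by (simp add: card_pinj)

section \<open>Chains are counted by their last points\<close>

text \<open>A point outside the domain is a dead end and every other point has only one way forward.
  So a walk that follows arrows in both directions from a dead end can never leave the set of
  points that lead to it.\<close>

lemma rtrancl_symcl_from_terminal:
  assumes "y \<notin> dom \<alpha>"
  shows "(y, x) \<in> (arrows \<alpha> \<union> (arrows \<alpha>)\<inverse>)\<^sup>* \<longleftrightarrow> (x, y) \<in> (arrows \<alpha>)\<^sup>*"
proof
  assume "(y, x) \<in> (arrows \<alpha> \<union> (arrows \<alpha>)\<inverse>)\<^sup>*"
  then show "(x, y) \<in> (arrows \<alpha>)\<^sup>*"
  proof (induction rule: rtrancl_induct)
    case base
    show ?case by simp
  next
    case (step x x')
    from step.hyps(2) consider "(x, x') \<in> arrows \<alpha>" | "(x', x) \<in> arrows \<alpha>" by blast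
    then show ?case
    proof cases
      case 1
      from step.IH show ?thesis
      proof (cases rule: converse_rtranclE)
        case base
        \<comment> \<open>The dead end \<open>x = y\<close> has no outgoing arrow.\<close>
        then show ?thesis using 1 assms by (auto simp: arrows_def)
      next
        case (step w)
        then have "w = x'" using 1 by (simp add: arrows_def)
        then show ?thesis using step by simp
      qed
    next
      case 2
      then show ?thesis using step.IH by (rule converse_rtrancl_into_rtrancl)
    qed
  qed
next
  assume "(x, y) \<in> (arrows \<alpha>)\<^sup>*"
  then have "(x, y) \<in> (arrows \<alpha> \<union> (arrows \<alpha>)\<inverse>)\<^sup>*"
    by (rule rtrancl_mono[THEN subsetD, rotated]) auto
  moreover have "sym ((arrows \<alpha> \<union> (arrows \<alpha>)\<inverse>)\<^sup>*)"
    by (intro sym_rtrancl) (auto simp: sym_def)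
  ultimately show "(y, x) \<in> (arrows \<alpha> \<union> (arrows \<alpha>)\<inverse>)\<^sup>*"
    by (auto dest: symD)
qed

text \<open>The component of a point outside the domain is a path and not a tree or a cycle: a longest
  path that ends there cannot be prolonged backwards, and by injectivity it absorbs everything
  that leads to its end.\<close>

lemma chain_into_terminal:
  assumes \<alpha>: "\<alpha> \<in> pinj A A" and fin: "finite A" and y: "y \<in> A" "y \<notin> dom \<alpha>"
  obtains xs where "xs \<noteq> []" "distinct xs" "set xs = {x. (x, y) \<in> (arrows \<alpha>)\<^sup>*}"
    "\<forall>i. Suc i < length xs \<longrightarrow> (xs ! i, xs ! Suc i) \<in> arrows \<alpha>" "hd xs \<notin> ran \<alpha>" "last xs = y"
proof -
  define P where "P = (\<lambda>xs. xs \<noteq> [] \<and> distinct xs \<and> set xs \<subseteq> A \<and> last xs = y \<and>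
    (\<forall>i. Suc i < length xs \<longrightarrow> (xs ! i, xs ! Suc i) \<in> arrows \<alpha>))"
  have "P [y]"
    using y by (simp add: P_def)
  moreover have "\<forall>xs. P xs \<longrightarrow> length xs < Suc (card A)"
    using fin by (auto simp: P_def less_Suc_eq_le distinct_card[symmetric] intro: card_mono)
  ultimately obtain xs where xs: "P xs" and max: "\<And>ys. P ys \<Longrightarrow> length ys \<le> length xs"
    using ex_has_greatest_nat[of P "[y]" length "Suc (card A)"] by blast
  have ne: "xs \<noteq> []" and dist: "distinct xs" and last: "last xs = y"
    and next_arrow: "\<And>i. Suc i < length xs \<Longrightarrow> \<alpha> (xs ! i) = Some (xs ! Suc i)"
    using xs by (auto simp: P_def arrows_def)
  have hd: "hd xs \<notin> ran \<alpha>"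
  proof
    assume "hd xs \<in> ran \<alpha>"
    then obtain b where b: "\<alpha> b = Some (hd xs)" by (auto simp: ran_def)
    show False
    proof (cases "b \<in> set xs")
      case False
      \<comment> \<open>A predecessor of the head would prolong a path of maximal length.\<close>
      have "P (b # xs)"
        using xs False b pinjD(1)[OF \<alpha> b] unfolding P_def
        by (auto simp: arrows_def nth_Cons hd_conv_nth split: nat.split)
      from max[OF this] show False by simp
    next
      case True
      \<comment> \<open>The predecessor would close a cycle through the head: inside the list this repeats a
        point, and at its end the dead end \<open>y\<close> would have an arrow.\<close>
      then obtain i where i: "i < length xs" "b = xs ! i" by (auto simp: in_set_conv_nth)
      show False
      proof (cases "Suc i < length xs")
        case True
        then have "xs ! Suc i = xs ! 0"
          using next_arrow[OF True] b i ne by (simp add: hd_conv_nth)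
        then show False
          using dist True ne by (simp add: nth_eq_iff_index_eq)
      next
        case False
        then have "i = length xs - 1" using i by simp
        then have "b = y" using i ne last by (simp add: last_conv_nth)
        then show False using b y by auto
      qed
    qed
  qed
  have "(xs ! i, y) \<in> (arrows \<alpha>)\<^sup>*" if "i < length xs" for i
    using that
  proof (induction "length xs - Suc i" arbitrary: i)
    case 0
    then have "i = length xs - 1" by simp
    then show ?case using ne last by (simp add: last_conv_nth)
  next
    case (Suc j)
    then have "Suc i < length xs" by simp
    moreover from this have "(xs ! Suc i, y) \<in> (arrows \<alpha>)\<^sup>*"
      using Suc by (intro Suc.hyps(1)) auto
    ultimately show ?case
      using next_arrow by (auto simp: arrows_def intro: converse_rtrancl_into_rtrancl)
  qed
  then have sub: "set xs \<subseteq> {x. (x, y) \<in> (arrows \<alpha>)\<^sup>*}"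
    by (auto simp: in_set_conv_nth)
  have "x \<in> set xs" if "(x, y) \<in> (arrows \<alpha>)\<^sup>*" for x
    using that
  proof (induction rule: converse_rtrancl_induct)
    case base
    show ?case using ne last by (metis last_in_set)
  next
    case (step x x')
    then obtain i where i: "i < length xs" "x' = xs ! i" by (auto simp: in_set_conv_nth)
    have "x' \<in> ran \<alpha>" using step.hyps(1) by (auto simp: arrows_def ran_def)
    then have "i \<noteq> 0" using hd ne i by (metis hd_conv_nth)
    then have "\<alpha> (xs ! (i - 1)) = Some x'"
      using next_arrow[of "i - 1"] i by simp
    then have "x = xs ! (i - 1)"
      using pinjD(3)[OF \<alpha>] step.hyps(1) by (auto simp: arrows_def)
    then show ?case using i by simp
  qed
  then have "set xs = {x. (x, y) \<in> (arrows \<alpha>)\<^sup>*}"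
    using sub by blast
  then show thesis
    using that[of xs] ne dist hd last next_arrow by (auto simp: arrows_def)
qed

text \<open>A chain is the component of its last point, and every point outside the domain is the last
  point of its component.\<close>

lemma card_chains:
  assumes \<alpha>: "\<alpha> \<in> sym_inv m"
  shows "card (chains m \<alpha>) = card ({1..m} - dom \<alpha>)"
proof -
  define S where "S = arrows \<alpha> \<union> (arrows \<alpha>)\<inverse>"
  have "bij_betw (\<lambda>y. S\<^sup>* `` {y}) ({1..m} - dom \<alpha>) (chains m \<alpha>)"
  proof (rule bij_betw_imageI)
    show "inj_on (\<lambda>y. S\<^sup>* `` {y}) ({1..m} - dom \<alpha>)"
    proof (rule inj_onI)
      fix y y'
      assume y: "y \<in> {1..m} - dom \<alpha>" and y': "y' \<in> {1..m} - dom \<alpha>" and eq: "S\<^sup>* `` {y} = S\<^sup>* `` {y'}"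
      have "(y, y') \<in> S\<^sup>*" using eq by auto
      then have "(y', y) \<in> (arrows \<alpha>)\<^sup>*"
        using y unfolding S_def by (subst (asm) rtrancl_symcl_from_terminal) auto
      then show "y = y'"
        using y' by (cases rule: converse_rtranclE) (auto simp: arrows_def)
    qed
    show "(\<lambda>y. S\<^sup>* `` {y}) ` ({1..m} - dom \<alpha>) = chains m \<alpha>"
    proof (intro equalityI subsetI)
      fix C assume "C \<in> (\<lambda>y. S\<^sup>* `` {y}) ` ({1..m} - dom \<alpha>)"
      then obtain y where y: "y \<in> {1..m}" "y \<notin> dom \<alpha>" and C: "C = S\<^sup>* `` {y}" by blast
      have "C = {x. (x, y) \<in> (arrows \<alpha>)\<^sup>*}"
        unfolding C S_def using rtrancl_symcl_from_terminal[OF y(2)] by auto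
      moreover obtain xs where "xs \<noteq> []" "distinct xs" "set xs = {x. (x, y) \<in> (arrows \<alpha>)\<^sup>*}"
        "\<forall>i. Suc i < length xs \<longrightarrow> (xs ! i, xs ! Suc i) \<in> arrows \<alpha>" "hd xs \<notin> ran \<alpha>" "last xs = y"
        using chain_into_terminal[OF \<alpha>[unfolded sym_inv_eq_pinj] _ y] by blast
      moreover have "C \<in> components m \<alpha>"
        using y C unfolding components_def S_def[symmetric] by (auto intro: quotientI)
      ultimately show "C \<in> chains m \<alpha>"
        using y unfolding chains_def by blast
    next
      fix C assume "C \<in> chains m \<alpha>"
      then obtain x xs where x: "x \<in> {1..m}" "C = S\<^sup>* `` {x}"
        and xs: "xs \<noteq> []" "set xs = C" "last xs \<notin> dom \<alpha>"
        unfolding chains_def components_def quotient_def S_def[symmetric] by blast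
      have sym: "sym (S\<^sup>*)" unfolding S_def by (intro sym_rtrancl) (auto simp: sym_def)
      have xy: "(x, last xs) \<in> S\<^sup>*" using x xs last_in_set by blast
      then have C: "C = S\<^sup>* `` {last xs}"
        using x(2) sym by (auto dest: symD rtrancl_trans)
      have "last xs \<in> {1..m}"
        using xy
      proof (induction rule: rtrancl_induct)
        case (step u v)
        then show ?case
          using pinjD(1,2)[OF \<alpha>[unfolded sym_inv_eq_pinj]] unfolding S_def arrows_def by blast
      qed (use x in auto)
      then show "C \<in> (\<lambda>y. S\<^sup>* `` {y}) ` ({1..m} - dom \<alpha>)"
        using C xs by blast
    qed
  qed
  then show ?thesis by (simp add: bij_betw_same_card)
qed

text \<open>Double counting of the pairs \<open>(\<alpha>, y)\<close> with \<open>\<alpha>\<close> undefined at \<open>y\<close>: for fixed \<open>\<alpha>\<close> they are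
  its chains, and for fixed \<open>y\<close> they are the partial injections from the other points.\<close>

lemma total_chains_eq: "total_chains m = m * rook_placements (m - 1) m"
proof -
  let ?A = "{1..m}"
  have fin: "finite (pinj ?A ?A)" by (simp add: finite_pinj)
  have "total_chains m = (\<Sum>\<alpha>\<in>pinj ?A ?A. \<Sum>y\<in>?A. if y \<notin> dom \<alpha> then 1 else 0)"
    unfolding total_chains_def
    by (auto simp: sum.If_cases card_chains sym_inv_eq_pinj Diff_eq Int_def intro!: sum.cong)
  also have "\<dots> = (\<Sum>y\<in>?A. \<Sum>\<alpha>\<in>pinj ?A ?A. if y \<notin> dom \<alpha> then 1 else 0)"
    by (rule sum.swap)
  also have "\<dots> = (\<Sum>y\<in>?A. card {\<alpha> \<in> pinj ?A ?A. \<alpha> y = None})"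
    using fin by (auto simp: sum.If_cases Int_def domIff intro!: sum.cong)
  also have "\<dots> = (\<Sum>y\<in>?A. rook_placements (m - 1) m)"
    by (intro sum.cong refl) (simp add: pinj_undefined_at card_pinj)
  finally show ?thesis by simp
qed

text \<open>Among the partial injections of \<open>m\<close> points into these points and a further one, those that
  avoid the further point contribute \<open>N(m, m)\<close>. The others have a chain that runs into it, and
  removing the last arrow marks one chain of a map on the \<open>m\<close> points.\<close>

lemma rook_placements_Suc_eq_total_chains:
  "rook_placements m (Suc m) = total_chains m + rook_placements m m"
  using rook_placements_commute[of m "Suc m"] rook_placements_commute[of m "m - 1"]
  by (simp add: total_chains_eq)

section \<open>Nilpotent maps\<close>

lemma ppow_eq_Some_iff: "ppow \<alpha> r x = Some y \<longleftrightarrow> (x, y) \<in> arrows \<alpha> ^^ r"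
  by (induction r arbitrary: y) (auto simp: map_comp_Some_iff arrows_def relcomp_unfold)

text \<open>Going around a cycle gives arbitrarily long walks. Without a cycle, all points of a walk are
  distinct, so no walk has more arrows than there are points.\<close>

lemma nilpotent_iff_acyclic:
  assumes \<alpha>: "\<alpha> \<in> pinj A A" and fin: "finite A"
  shows "(\<exists>r>0. ppow \<alpha> r = Map.empty) \<longleftrightarrow> acyclic (arrows \<alpha>)"
proof
  assume "\<exists>r>0. ppow \<alpha> r = Map.empty"
  then obtain r where r: "r > 0" "ppow \<alpha> r = Map.empty" by blast
  have empty: "arrows \<alpha> ^^ r = {}"
  proof (rule equals0I)
    fix p assume "p \<in> arrows \<alpha> ^^ r"
    then show False using ppow_eq_Some_iff[of \<alpha> r "fst p" "snd p"] r by simp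
  qed
  show "acyclic (arrows \<alpha>)"
  proof (rule acyclicI, rule allI, rule notI)
    fix x assume "(x, x) \<in> (arrows \<alpha>)\<^sup>+"
    then obtain p where p: "p > 0" "(x, x) \<in> arrows \<alpha> ^^ p" by (auto simp: trancl_power)
    \<comment> \<open>Turning \<open>r\<close> times around a cycle of length \<open>p\<close> is a walk of length at least \<open>r\<close>.\<close>
    have "(x, x) \<in> arrows \<alpha> ^^ (i * p)" for i
      by (induction i) (use p in \<open>auto simp: relpow_add\<close>)
    then have "(x, x) \<in> arrows \<alpha> ^^ (r * p)" .
    also have "r * p = r + r * (p - 1)"
      using p by (cases p) auto
    also have "arrows \<alpha> ^^ \<dots> = {}"
      using empty by (simp add: relpow_add)
    finally show False by simp
  qed
next
  assume acyc: "acyclic (arrows \<alpha>)"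
  have "ppow \<alpha> (Suc (card A)) = Map.empty"
  proof (rule ext, rule ccontr)
    fix x assume "ppow \<alpha> (Suc (card A)) x \<noteq> None"
    then obtain y where "(x, y) \<in> arrows \<alpha> ^^ Suc (card A)"
      using ppow_eq_Some_iff by fast
    then obtain f where f: "\<And>i. i < Suc (card A) \<Longrightarrow> (f i, f (Suc i)) \<in> arrows \<alpha>"
      unfolding relpow_fun_conv by blast
    have less: "(f i, f (i + Suc d)) \<in> (arrows \<alpha>)\<^sup>+" if "i + Suc d \<le> Suc (card A)" for i d
      using that
    proof (induction d)
      case 0
      then show ?case using f[of i] by auto
    next
      case (Suc d)
      then show ?case using f[of "i + Suc d"] by (auto intro: trancl_into_trancl)
    qed
    have neq: "f i \<noteq> f j" if "i < j" "j \<le> card A" for i j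
    proof -
      from that have "(f i, f j) \<in> (arrows \<alpha>)\<^sup>+"
        using less[of i "j - Suc i"] by simp
      then show ?thesis using acyc by (auto simp: acyclic_def)
    qed
    have "inj_on f {..card A}"
    proof (rule inj_onI)
      fix i j assume "i \<in> {..card A}" "j \<in> {..card A}" "f i = f j"
      then show "i = j" using neq[of i j] neq[of j i] by (cases i j rule: linorder_cases) auto
    qed
    moreover have "f ` {..card A} \<subseteq> A"
    proof clarify
      fix i assume "i \<le> card A"
      then have "\<alpha> (f i) = Some (f (Suc i))" using f[of i] by (simp add: arrows_def)
      then show "f i \<in> A" using pinjD(1)[OF \<alpha>] by blast
    qed
    ultimately have "card {..card A} \<le> card A"
      using fin by (metis card_image card_mono)
    then show False by simp
  qed
  then show "\<exists>r>0. ppow \<alpha> r = Map.empty" by blast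
qed

text \<open>A multiplication principle for the maps in \<open>F\<close> with a given domain. If the number of values
  that may be added at a new point depends only on the size of the domain so far, the order in
  which the domain is filled is irrelevant and the numbers multiply. Once the truncated difference
  \<open>r - i\<close> reaches 0 there are no maps with a larger domain, and the product vanishes too.\<close>

lemma card_maps_with_dom:
  fixes F :: "('a \<rightharpoonup> 'b) set"
  assumes "finite E" "E \<subseteq> A"
    and empty: "Map.empty \<in> F"
    and restr: "\<And>\<alpha> X. \<alpha> \<in> F \<Longrightarrow> \<alpha> |` X \<in> F"
    and fin: "\<And>\<alpha> x. finite {y. \<alpha>(x \<mapsto> y) \<in> F}"
    and ext: "\<And>\<alpha> x. \<alpha> \<in> F \<Longrightarrow> dom \<alpha> \<subseteq> A \<Longrightarrow> finite (dom \<alpha>) \<Longrightarrow> x \<in> A - dom \<alpha> \<Longrightarrow>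
      card {y. \<alpha>(x \<mapsto> y) \<in> F} = r - card (dom \<alpha>)"
  shows "finite {\<alpha> \<in> F. dom \<alpha> = E} \<and> card {\<alpha> \<in> F. dom \<alpha> = E} = (\<Prod>i<card E. r - i)"
  using assms(1,2)
proof (induction E rule: finite_induct)
  case empty
  have "{\<alpha> \<in> F. dom \<alpha> = {}} = {Map.empty}"
    using assms(3) by auto
  then show ?case by simp
next
  case (insert x E)
  let ?G = "{\<alpha> \<in> F. dom \<alpha> = E}"
  let ?S = "SIGMA \<alpha>:?G. {y. \<alpha>(x \<mapsto> y) \<in> F}"
  let ?ins = "\<lambda>(\<alpha>, y). \<alpha>(x \<mapsto> y)"
  have IH: "finite ?G" "card ?G = (\<Prod>i<card E. r - i)"
    using insert by auto
  have inj: "inj_on ?ins ?S"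
  proof (rule inj_onI, clarify)
    fix \<alpha> \<beta> :: "'a \<rightharpoonup> 'b" and y z
    assume dom: "E = dom \<alpha>" "dom \<beta> = dom \<alpha>" and eq: "\<alpha>(x \<mapsto> y) = \<beta>(x \<mapsto> z)"
    have "\<alpha> u = \<beta> u" for u
      using fun_cong[OF eq, of u] insert.hyps(2) dom by (cases "u = x") (simp_all, metis domIff)
    moreover have "y = z" using fun_cong[OF eq, of x] by simp
    ultimately show "\<alpha> = \<beta> \<and> y = z" by auto
  qed
  have image: "?ins ` ?S = {\<alpha> \<in> F. dom \<alpha> = insert x E}"
  proof (intro equalityI subsetI)
    fix \<alpha> assume "\<alpha> \<in> {\<alpha> \<in> F. dom \<alpha> = insert x E}"
    then have \<alpha>: "\<alpha> \<in> F" "dom \<alpha> = insert x E" by auto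
    then obtain y where y: "\<alpha> x = Some y" by blast
    then have eq: "(\<alpha> |` E)(x \<mapsto> y) = \<alpha>"
      using \<alpha>(2) by (auto simp: restrict_map_def fun_eq_iff domIff)
    have "dom (\<alpha> |` E) = E" using \<alpha>(2) by auto
    then have "(\<alpha> |` E, y) \<in> ?S"
      using restr[OF \<alpha>(1)] eq \<alpha>(1) by simp
    then show "\<alpha> \<in> ?ins ` ?S"
      using eq by (intro image_eqI[where x = "(\<alpha> |` E, y)"]) auto
  qed auto
  have "card (?ins ` ?S) = card ?S" using inj by (rule card_image)
  also have "\<dots> = (\<Sum>\<alpha>\<in>?G. card {y. \<alpha>(x \<mapsto> y) \<in> F})"
    using IH(1) fin by (intro card_SigmaI) auto
  also have "\<dots> = (\<Sum>\<alpha>\<in>?G. r - card E)"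
    using insert by (intro sum.cong refl) (auto simp: ext)
  also have "\<dots> = (\<Prod>i<card (insert x E). r - i)"
    using insert.hyps IH by simp
  finally have "card {\<alpha> \<in> F. dom \<alpha> = insert x E} = (\<Prod>i<card (insert x E). r - i)"
    unfolding image .
  moreover have "finite (?ins ` ?S)"
    using IH(1) fin by (intro finite_imageI finite_SigmaI) auto
  ultimately show ?case unfolding image by simp
qed

lemma card_pinj_with_dom:
  assumes "finite D" "finite R" "E \<subseteq> D"
  shows "card {\<alpha> \<in> pinj D R. dom \<alpha> = E} = (\<Prod>i<card E. card R - i)"
proof -
  have "finite {\<alpha> \<in> pinj D R. dom \<alpha> = E} \<and>
    card {\<alpha> \<in> pinj D R. dom \<alpha> = E} = (\<Prod>i<card E. card R - i)"
  proof (rule card_maps_with_dom[where A = D])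
    fix \<alpha> :: "'a \<rightharpoonup> 'b" and x
    have "{y. \<alpha>(x \<mapsto> y) \<in> pinj D R} \<subseteq> R"
      using pinjD(2)[of "\<alpha>(x \<mapsto> _)" D R x] by auto
    then show "finite {y. \<alpha>(x \<mapsto> y) \<in> pinj D R}"
      using assms(2) by (rule finite_subset)
  next
    fix \<alpha> :: "'a \<rightharpoonup> 'b" and x
    assume \<alpha>: "\<alpha> \<in> pinj D R" "x \<in> D - dom \<alpha>"
    then have "{y. \<alpha>(x \<mapsto> y) \<in> pinj D R} = R - ran \<alpha>"
      by (auto simp: fun_upd_in_pinj_iff)
    moreover have "ran \<alpha> \<subseteq> R" using \<alpha>(1) by (simp add: pinj_def)
    ultimately show "card {y. \<alpha>(x \<mapsto> y) \<in> pinj D R} = card R - card (dom \<alpha>)"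
      using assms(2) card_ran_pinj[OF \<alpha>(1)] by (simp add: card_Diff_subset finite_subset)
  qed (use assms in \<open>auto intro: pinjI restrict_map_in_pinj finite_subset\<close>)
  then show ?thesis by simp
qed

text \<open>Walking backwards from \<open>x\<close> is deterministic by injectivity, and without cycles the walk must
  stop.\<close>

lemma ex1_chain_start:
  assumes \<alpha>: "\<alpha> \<in> pinj A A" and fin: "finite A" and acyc: "acyclic (arrows \<alpha>)" and x: "x \<in> A"
  shows "\<exists>!s. s \<in> A - ran \<alpha> \<and> (s, x) \<in> (arrows \<alpha>)\<^sup>*"
proof (rule ex_ex1I)
  have sub: "arrows \<alpha> \<subseteq> A \<times> A"
    using pinjD(1,2)[OF \<alpha>] by (auto simp: arrows_def)
  then have "finite (arrows \<alpha>)" using fin finite_subset by blast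
  then have "wf (arrows \<alpha>)" using acyc by (rule finite_acyclic_wf)
  then obtain s where s: "(s, x) \<in> (arrows \<alpha>)\<^sup>*"
    and min: "\<And>u. (u, s) \<in> arrows \<alpha> \<Longrightarrow> (u, x) \<notin> (arrows \<alpha>)\<^sup>*"
    using wfE_min[of "arrows \<alpha>" x "{u. (u, x) \<in> (arrows \<alpha>)\<^sup>*}"] by auto
  have "s \<in> A"
    using s x sub by (cases rule: converse_rtranclE) auto
  moreover have "s \<notin> ran \<alpha>"
  proof
    assume "s \<in> ran \<alpha>"
    then obtain u where "(u, s) \<in> arrows \<alpha>" by (auto simp: ran_def arrows_def)
    then show False using min s converse_rtrancl_into_rtrancl by metis
  qed
  ultimately show "\<exists>s. s \<in> A - ran \<alpha> \<and> (s, x) \<in> (arrows \<alpha>)\<^sup>*" using s by blast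
next
  fix s t
  assume s: "s \<in> A - ran \<alpha> \<and> (s, x) \<in> (arrows \<alpha>)\<^sup>*" and t: "t \<in> A - ran \<alpha> \<and> (t, x) \<in> (arrows \<alpha>)\<^sup>*"
  have start: "v = u" if "(v, u) \<in> (arrows \<alpha>)\<^sup>*" "u \<notin> ran \<alpha>" for u v
    using that by (cases rule: rtranclE) (auto simp: arrows_def ran_def)
  have "single_valued ((arrows \<alpha>)\<inverse>)"
    using pinjD(3)[OF \<alpha>] by (auto simp: single_valued_def arrows_def)
  then have "(s, t) \<in> ((arrows \<alpha>)\<inverse>)\<^sup>* \<or> (t, s) \<in> ((arrows \<alpha>)\<inverse>)\<^sup>*"
    using s t by (intro single_valued_confluent[of _ x]) (auto simp: rtrancl_converse)
  then show "s = t"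
    using s t start[of s t] start[of t s] by (auto simp: rtrancl_converse)
qed

text \<open>A new arrow \<open>x \<rightarrow> y\<close> closes a cycle iff \<open>y\<close> leads to \<open>x\<close>. Among the values \<open>y\<close> not yet taken
  this excludes exactly one, the start of the chain that ends in \<open>x\<close>, which explains the
  \<open>card A - 1\<close>.\<close>

lemma card_acyclic_with_dom:
  assumes fin: "finite A" and "E \<subseteq> A"
  shows "card {\<alpha> \<in> pinj A A. acyclic (arrows \<alpha>) \<and> dom \<alpha> = E} = (\<Prod>i<card E. card A - 1 - i)"
proof -
  let ?F = "{\<alpha> \<in> pinj A A. acyclic (arrows \<alpha>)}"
  have "finite {\<alpha> \<in> ?F. dom \<alpha> = E} \<and>
    card {\<alpha> \<in> ?F. dom \<alpha> = E} = (\<Prod>i<card E. card A - 1 - i)"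
  proof (rule card_maps_with_dom[where A = A])
    fix \<alpha> :: "'a \<rightharpoonup> 'a" and X assume \<alpha>: "\<alpha> \<in> ?F"
    have "arrows (\<alpha> |` X) \<subseteq> arrows \<alpha>"
      by (auto simp: arrows_def restrict_map_def split: if_splits)
    then show "\<alpha> |` X \<in> ?F"
      using \<alpha> by (auto intro: restrict_map_in_pinj acyclic_subset)
  next
    fix \<alpha> :: "'a \<rightharpoonup> 'a" and x
    have "{y. \<alpha>(x \<mapsto> y) \<in> ?F} \<subseteq> A"
      using pinjD(2)[of "\<alpha>(x \<mapsto> _)" A A x] by auto
    then show "finite {y. \<alpha>(x \<mapsto> y) \<in> ?F}"
      using fin by (rule finite_subset)
  next
    fix \<alpha> :: "'a \<rightharpoonup> 'a" and x
    assume "\<alpha> \<in> ?F" and x: "x \<in> A - dom \<alpha>"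
    then have \<alpha>: "\<alpha> \<in> pinj A A" and acyc: "acyclic (arrows \<alpha>)" by auto
    obtain s where s: "s \<in> A - ran \<alpha>" "(s, x) \<in> (arrows \<alpha>)\<^sup>*"
      and uniq: "\<And>t. t \<in> A - ran \<alpha> \<Longrightarrow> (t, x) \<in> (arrows \<alpha>)\<^sup>* \<Longrightarrow> t = s"
      using ex1_chain_start[OF \<alpha> fin acyc] x by blast
    have arrows_upd: "arrows (\<alpha>(x \<mapsto> y)) = insert (x, y) (arrows \<alpha>)" for y
      using x by (auto simp: arrows_def split: if_splits)
    have "{y. \<alpha>(x \<mapsto> y) \<in> ?F} = A - ran \<alpha> - {s}"
    proof (intro equalityI subsetI)
      fix y assume "y \<in> {y. \<alpha>(x \<mapsto> y) \<in> ?F}"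
      then have "y \<in> A - ran \<alpha>" "(y, x) \<notin> (arrows \<alpha>)\<^sup>*"
        using x arrows_upd[of y] fun_upd_in_pinj_iff[OF \<alpha>, of x y] by auto
      then show "y \<in> A - ran \<alpha> - {s}" using s by blast
    next
      fix y assume y: "y \<in> A - ran \<alpha> - {s}"
      then have "(y, x) \<notin> (arrows \<alpha>)\<^sup>*" using uniq by blast
      then show "y \<in> {y. \<alpha>(x \<mapsto> y) \<in> ?F}"
        using x y acyc arrows_upd[of y] fun_upd_in_pinj_iff[OF \<alpha>, of x y] by simp
    qed
    moreover have "ran \<alpha> \<subseteq> A" using \<alpha> by (simp add: pinj_def)
    ultimately show "card {y. \<alpha>(x \<mapsto> y) \<in> ?F} = card A - 1 - card (dom \<alpha>)"
      using s fin card_ran_pinj[OF \<alpha>] by (simp add: card_Diff_subset finite_subset)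
  qed (use assms in \<open>auto intro: pinjI finite_subset acyclicI simp: arrows_def\<close>)
  then show ?thesis by simp
qed

text \<open>Domain by domain there are as many nilpotent maps on \<open>m\<close> points as partial injections into a
  set of \<open>m - 1\<close> points.\<close>

lemma card_nilpotents: "card (nilpotents m) = rook_placements m (m - 1)"
proof -
  let ?A = "{1..m}" and ?R = "{1..m - 1}"
  have by_dom: "card X = (\<Sum>E\<in>Pow ?A. card {\<alpha> \<in> X. dom \<alpha> = E})"
    if "X \<subseteq> {\<alpha>. dom \<alpha> \<subseteq> ?A}" "finite X" for X :: "(nat \<rightharpoonup> nat) set"
  proof -
    have "X = (\<Union>E\<in>Pow ?A. {\<alpha> \<in> X. dom \<alpha> = E})" using that(1) by blast
    also have "card \<dots> = (\<Sum>E\<in>Pow ?A. card {\<alpha> \<in> X. dom \<alpha> = E})"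
      using that(2) by (intro card_UN_disjoint) auto
    finally show ?thesis .
  qed
  have "nilpotents m = {\<alpha> \<in> pinj ?A ?A. acyclic (arrows \<alpha>)}"
    unfolding nilpotents_def sym_inv_eq_pinj using nilpotent_iff_acyclic[of _ ?A] by blast
  then have "card (nilpotents m) = (\<Sum>E\<in>Pow ?A. card {\<alpha> \<in> {\<alpha> \<in> pinj ?A ?A. acyclic (arrows \<alpha>)}. dom \<alpha> = E})"
    by (simp only:) (rule by_dom, auto simp: pinj_def intro: finite_subset[OF _ finite_pinj[of ?A ?A]])
  also have "\<dots> = (\<Sum>E\<in>Pow ?A. card {\<alpha> \<in> pinj ?A ?R. dom \<alpha> = E})"
    by (intro sum.cong refl) (simp add: card_acyclic_with_dom card_pinj_with_dom)
  also have "\<dots> = card (pinj ?A ?R)"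
    by (rule by_dom[symmetric]) (auto simp: pinj_def intro: finite_pinj[unfolded pinj_def])
  finally show ?thesis by (simp add: card_pinj)
qed

section \<open>Maps with an orbit of prescribed length\<close>

lemma porbit_eq: "porbit \<alpha> x = (if x \<in> dom \<alpha> then (arrows \<alpha>)\<^sup>* `` {x} else {})"
  by (auto simp: porbit_def ppow_eq_Some_iff rtrancl_power)

lemma orbit_subset:
  assumes "\<alpha> \<in> pinj A A" "a \<in> A"
  shows "(arrows \<alpha>)\<^sup>* `` {a} \<subseteq> A"
proof clarify
  fix x assume "(a, x) \<in> (arrows \<alpha>)\<^sup>*"
  then show "x \<in> A"
    using assms(2) pinjD(2)[OF assms(1)] by (cases rule: rtranclE) (auto simp: arrows_def)
qed

lemma orbit_closed:
  assumes "a \<in> S" "\<And>x y. x \<in> S \<Longrightarrow> \<alpha> x = Some y \<Longrightarrow> y \<in> S"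
  shows "(arrows \<alpha>)\<^sup>* `` {a} \<subseteq> S"
proof clarify
  fix x assume "(a, x) \<in> (arrows \<alpha>)\<^sup>*"
  then show "x \<in> S"
    by (induction rule: rtrancl_induct) (use assms in \<open>auto simp: arrows_def\<close>)
qed

text \<open>The graph of \<open>\<beta>\<close> is a single path from \<open>a\<close> to \<open>z\<close> with vertex set \<open>S\<close>. The reachability
  condition rules out additional cycles.\<close>

definition path_map :: "'a \<Rightarrow> 'a \<Rightarrow> 'a set \<Rightarrow> ('a \<rightharpoonup> 'a) \<Rightarrow> bool" where
  "path_map a z S \<beta> \<longleftrightarrow> a \<in> S \<and> z \<in> S \<and> \<beta> \<in> pinj S S \<and> dom \<beta> = S - {z} \<and> ran \<beta> = S - {a} \<and>
     S \<subseteq> (arrows \<beta>)\<^sup>* `` {a}"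

lemma rtrancl_arrows_mono: "\<beta> \<subseteq>\<^sub>m \<alpha> \<Longrightarrow> (arrows \<beta>)\<^sup>* \<subseteq> (arrows \<alpha>)\<^sup>*"
  by (intro rtrancl_mono) (auto simp: arrows_def map_le_def dom_def)

lemma path_map_extend:
  assumes "path_map a z S \<beta>" "y \<notin> S"
  shows "path_map a y (insert y S) (\<beta>(z \<mapsto> y))"
proof -
  have S: "a \<in> S" "z \<in> S" "\<beta> \<in> pinj S S" "dom \<beta> = S - {z}" "ran \<beta> = S - {a}"
    "S \<subseteq> (arrows \<beta>)\<^sup>* `` {a}"
    using assms by (auto simp: path_map_def)
  have z: "\<beta> z = None" using S by auto
  have "pinj S S \<subseteq> pinj (insert y S) (insert y S)" by (auto simp: pinj_def)
  then have "\<beta> \<in> pinj (insert y S) (insert y S)" using S by blast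
  then have "\<beta>(z \<mapsto> y) \<in> pinj (insert y S) (insert y S)"
    using S assms(2) by (subst fun_upd_in_pinj_iff) auto
  moreover have "ran (\<beta>(z \<mapsto> y)) = insert y S - {a}"
    using S z assms(2) by auto
  moreover have "insert y S \<subseteq> (arrows (\<beta>(z \<mapsto> y)))\<^sup>* `` {a}"
  proof -
    have "\<beta> \<subseteq>\<^sub>m \<beta>(z \<mapsto> y)" using z by (auto simp: map_le_def)
    then have "S \<subseteq> (arrows (\<beta>(z \<mapsto> y)))\<^sup>* `` {a}"
      using rtrancl_arrows_mono S(6) by blast
    moreover from this have "(a, z) \<in> (arrows (\<beta>(z \<mapsto> y)))\<^sup>*" using S(2) by blast
    then have "(a, y) \<in> (arrows (\<beta>(z \<mapsto> y)))\<^sup>*"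
      by (rule rtrancl_into_rtrancl) (simp add: arrows_def)
    ultimately show ?thesis by auto
  qed
  ultimately show ?thesis
    using S assms(2) by (auto simp: path_map_def)
qed

lemma path_map_trivial:
  assumes "path_map a a S \<beta>"
  shows "S = {a}"
proof -
  have "(arrows \<beta>)\<^sup>* `` {a} \<subseteq> {a}"
    using assms by (intro orbit_closed) (auto simp: path_map_def)
  then show ?thesis using assms by (auto simp: path_map_def)
qed

text \<open>All points of the path except \<open>z\<close> already have their values in any extension. Hence the orbit
  of \<open>a\<close> stops growing exactly when \<open>z\<close> does not leave \<open>S\<close>; and the only value in \<open>S\<close> still free
  for \<open>z\<close> is \<open>a\<close>.\<close>

lemma orbit_extending_path:
  assumes \<beta>: "path_map a z S \<beta>" and \<alpha>: "\<alpha> \<in> pinj A A" and le: "\<beta> \<subseteq>\<^sub>m \<alpha>"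
  shows "S \<subseteq> (arrows \<alpha>)\<^sup>* `` {a}"
    and "(\<And>y. \<alpha> z = Some y \<Longrightarrow> y \<in> S) \<Longrightarrow> (arrows \<alpha>)\<^sup>* `` {a} = S"
    and "\<alpha> z = Some y \<Longrightarrow> y \<in> S \<Longrightarrow> y = a"
    and "\<alpha> z = Some y \<Longrightarrow> y \<in> (arrows \<alpha>)\<^sup>* `` {a}"
proof -
  have S: "a \<in> S" "z \<in> S" "\<beta> \<in> pinj S S" "dom \<beta> = S - {z}" "ran \<beta> = S - {a}"
    "S \<subseteq> (arrows \<beta>)\<^sup>* `` {a}"
    using \<beta> by (auto simp: path_map_def)
  have val: "\<alpha> x = \<beta> x" if "x \<in> S" "x \<noteq> z" for x
    using le that S(4) by (auto simp: map_le_def)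
  show sub: "S \<subseteq> (arrows \<alpha>)\<^sup>* `` {a}"
    using rtrancl_arrows_mono[OF le] S(6) by blast
  show "(arrows \<alpha>)\<^sup>* `` {a} = S" if z: "\<And>y. \<alpha> z = Some y \<Longrightarrow> y \<in> S"
  proof (rule equalityI[OF orbit_closed sub])
    fix x y assume "x \<in> S" "\<alpha> x = Some y"
    then show "y \<in> S"
      using z val[of x] pinjD(2)[OF S(3), of x y] by (cases "x = z") auto
  qed (rule S(1))
  show "y = a" if y: "\<alpha> z = Some y" "y \<in> S"
  proof (rule ccontr)
    assume "y \<noteq> a"
    then obtain w where w: "\<beta> w = Some y" using S(5) y by (auto simp: ran_def)
    then have "w \<in> S" "w \<noteq> z" using S(4) by auto
    then have "\<alpha> w = Some y" using val w by simp
    then show False using pinjD(3)[OF \<alpha> y(1)] \<open>w \<noteq> z\<close> by blast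
  qed
  show "y \<in> (arrows \<alpha>)\<^sup>* `` {a}" if "\<alpha> z = Some y"
    using that sub S(2) by (auto simp: arrows_def intro: rtrancl_into_rtrancl)
qed

lemma map_le_upd_iff:
  assumes "z \<notin> dom \<beta>"
  shows "\<beta>(z \<mapsto> y) \<subseteq>\<^sub>m \<alpha> \<longleftrightarrow> \<beta> \<subseteq>\<^sub>m \<alpha> \<and> \<alpha> z = Some y"
  using assms by (auto simp: map_le_def)

text \<open>Once the path has all \<open>k\<close> points of the orbit, its end \<open>z\<close> closes it to a cycle or is outside
  the domain. In the second case \<open>a\<close> is still available as a value, so the remaining partial
  injection has one more value than arguments: this is where the chains come in.\<close>

lemma card_extending_full_path:
  assumes fin: "finite A" and SA: "S \<subseteq> A" and \<beta>: "path_map a z S \<beta>" and k: "card S = k" "1 < k"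
  shows "card {\<alpha> \<in> pinj A A. \<beta> \<subseteq>\<^sub>m \<alpha> \<and> card (porbit \<alpha> a) = k}
    = total_chains (card A - k) + 2 * rook_placements (card A - k) (card A - k)"
proof -
  let ?m = "card A - k"
  have S: "a \<in> S" "z \<in> S" "\<beta> \<in> pinj S S" "dom \<beta> = S - {z}" "ran \<beta> = S - {a}"
    using \<beta> by (auto simp: path_map_def)
  have finS: "finite S" using fin SA by (rule finite_subset[rotated])
  \<comment> \<open>Here \<open>k > 1\<close> enters. For \<open>a = z\<close> the orbit in the open case would be empty by convention.\<close>
  have "a \<noteq> z" using path_map_trivial \<beta> k by fastforce
  then have a: "a \<in> dom \<beta>" using S by auto
  have \<beta>A: "\<beta> \<in> pinj A A" "\<beta> \<in> pinj (A - {z}) A"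
    using S SA unfolding pinj_def by auto
  let ?closed = "{\<alpha> \<in> pinj A A. \<beta>(z \<mapsto> a) \<subseteq>\<^sub>m \<alpha>}" and ?open = "{\<alpha> \<in> pinj (A - {z}) A. \<beta> \<subseteq>\<^sub>m \<alpha>}"
  have iff: "card (porbit \<alpha> a) = k \<longleftrightarrow> \<alpha> z = Some a \<or> \<alpha> z = None"
    if \<alpha>: "\<alpha> \<in> pinj A A" "\<beta> \<subseteq>\<^sub>m \<alpha>" for \<alpha>
  proof -
    note orb = orbit_extending_path[OF \<beta> \<alpha>]
    have "porbit \<alpha> a = (arrows \<alpha>)\<^sup>* `` {a}"
      using a map_le_implies_dom_le[OF \<alpha>(2)] by (auto simp: porbit_eq)
    moreover have "finite ((arrows \<alpha>)\<^sup>* `` {a})"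
      using S(1) SA by (intro finite_subset[OF orbit_subset[OF \<alpha>(1)] fin]) auto
    ultimately have "card (porbit \<alpha> a) = k \<longleftrightarrow> (arrows \<alpha>)\<^sup>* `` {a} = S"
      using card_subset_eq[OF _ orb(1)] k(1) by (intro iffI) simp_all
    also have "\<dots> \<longleftrightarrow> \<alpha> z = Some a \<or> \<alpha> z = None"
      using orb(2-4) S(1) by (cases "\<alpha> z") auto
    finally show ?thesis .
  qed
  have z: "z \<notin> dom \<beta>" using S by simp
  have "{\<alpha> \<in> pinj A A. \<beta> \<subseteq>\<^sub>m \<alpha> \<and> card (porbit \<alpha> a) = k} = ?closed \<union> ?open"
    using iff map_le_upd_iff[OF z] pinj_undefined_at[of A A z] by blast
  moreover have "?closed \<inter> ?open = {}"
    using map_le_upd_iff[OF z] pinj_undefined_at[of A A z, symmetric] by auto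
  moreover have "finite ?closed" "finite ?open"
    using finite_pinj[OF fin fin] finite_pinj[of "A - {z}" A] fin by auto
  ultimately have "card {\<alpha> \<in> pinj A A. \<beta> \<subseteq>\<^sub>m \<alpha> \<and> card (porbit \<alpha> a) = k} = card ?closed + card ?open"
    by (simp add: card_Un_disjoint)
  also have "card ?closed = rook_placements ?m ?m"
  proof -
    have mem: "\<beta>(z \<mapsto> a) \<in> pinj A A"
      using fun_upd_in_pinj_iff[OF \<beta>A(1) z] S SA by auto
    have dom: "dom (\<beta>(z \<mapsto> a)) = S"
      using S(2,4) by (simp add: insert_absorb)
    have ran: "ran (\<beta>(z \<mapsto> a)) = S"
      using S(1,5) z by (simp add: domIff insert_absorb)
    show ?thesis
      using card_pinj_extending[OF mem] card_Diff_subset[OF finS SA] fin k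
      unfolding dom ran by (simp add: card_pinj)
  qed
  also have "card ?open = rook_placements ?m (Suc ?m)"
  proof -
    have "card (A - (S - {a})) = Suc ?m"
    proof -
      have "card S \<le> card A" using SA fin by (simp add: card_mono)
      then show ?thesis
        using SA fin finS k S by (subst card_Diff_subset) auto
    qed
    moreover have "A - {z} - (S - {z}) = A - S" using S SA by auto
    ultimately show ?thesis
      using SA fin finS k S \<beta>A(2) by (simp add: card_pinj_extending card_pinj card_Diff_subset)
  qed
  finally show ?thesis by (simp add: rook_placements_Suc_eq_total_chains)
qed

text \<open>While the path is too short for the orbit, its end must be sent to one of the points outside
  the path. Each choice prolongs the path by one point, and \<open>d\<close> counts the points still to be
  chosen.\<close>

lemma card_extending_path:
  assumes fin: "finite A" and "1 < k" "k \<le> card A"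
  shows "S \<subseteq> A \<Longrightarrow> path_map a z S \<beta> \<Longrightarrow> card S + d = k \<Longrightarrow>
    card {\<alpha> \<in> pinj A A. \<beta> \<subseteq>\<^sub>m \<alpha> \<and> card (porbit \<alpha> a) = k}
    = (\<Prod>i<d. card A - card S - i)
      * (total_chains (card A - k) + 2 * rook_placements (card A - k) (card A - k))"
proof (induction d arbitrary: S z \<beta>)
  case 0
  then show ?case using card_extending_full_path[OF fin] assms by simp
next
  case (Suc d)
  let ?c = "total_chains (card A - k) + 2 * rook_placements (card A - k) (card A - k)"
  let ?X = "\<lambda>\<beta>. {\<alpha> \<in> pinj A A. \<beta> \<subseteq>\<^sub>m \<alpha> \<and> card (porbit \<alpha> a) = k}"
  have z: "z \<notin> dom \<beta>" using Suc.prems(2) by (simp add: path_map_def)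
  have finS: "finite S" using fin Suc.prems(1) by (rule finite_subset[rotated])
  have "\<exists>y\<in>A - S. \<alpha> z = Some y" if "\<alpha> \<in> ?X \<beta>" for \<alpha>
  proof -
    have \<alpha>: "\<alpha> \<in> pinj A A" "\<beta> \<subseteq>\<^sub>m \<alpha>" "card (porbit \<alpha> a) = k" using that by auto
    then have "porbit \<alpha> a \<noteq> {}" using assms(2) by auto
    then have "porbit \<alpha> a = (arrows \<alpha>)\<^sup>* `` {a}" by (simp add: porbit_eq split: if_splits)
    then have "(arrows \<alpha>)\<^sup>* `` {a} \<noteq> S" using \<alpha>(3) Suc.prems(3) by auto
    then obtain y where "\<alpha> z = Some y" "y \<notin> S"
      using orbit_extending_path(2)[OF Suc.prems(2) \<alpha>(1,2)] by blast
    then show ?thesis using pinjD(2)[OF \<alpha>(1)] by blast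
  qed
  then have "?X \<beta> = (\<Union>y\<in>A - S. ?X (\<beta>(z \<mapsto> y)))"
    using map_le_upd_iff[OF z] by blast
  then have "card (?X \<beta>) = card (\<Union>y\<in>A - S. ?X (\<beta>(z \<mapsto> y)))" by simp
  also have "\<dots> = (\<Sum>y\<in>A - S. card (?X (\<beta>(z \<mapsto> y))))"
    using fin finite_pinj[OF fin fin] by (intro card_UN_disjoint) (auto simp: map_le_upd_iff[OF z])
  also have "\<dots> = (\<Sum>y\<in>A - S. (\<Prod>i<d. card A - Suc (card S) - i) * ?c)"
  proof (rule sum.cong[OF refl])
    fix y assume y: "y \<in> A - S"
    have "card (?X (\<beta>(z \<mapsto> y))) = (\<Prod>i<d. card A - card (insert y S) - i) * ?c"
    proof (rule Suc.IH)
      show "insert y S \<subseteq> A" using Suc.prems(1) y by simp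
      show "path_map a y (insert y S) (\<beta>(z \<mapsto> y))"
        using y by (intro path_map_extend[OF Suc.prems(2)]) simp
      show "card (insert y S) + d = k" using Suc.prems(3) y finS by simp
    qed
    then show "card (?X (\<beta>(z \<mapsto> y))) = (\<Prod>i<d. card A - Suc (card S) - i) * ?c"
      using y finS by simp
  qed
  also have "\<dots> = (\<Prod>i<Suc d. card A - card S - i) * ?c"
    using Suc.prems(1) finS by (simp add: card_Diff_subset prod.lessThan_Suc_shift del: prod.lessThan_Suc)
  finally show ?case .
qed

text \<open>Start with the path that consists of the point 1 alone.\<close>

lemma orbit_count_eq:
  assumes "1 < k" "k \<le> n"
  shows "orbit_count n k = (\<Prod>i<k - 1. n - 1 - i) * (total_chains (n - k) + 2 * card (sym_inv (n - k)))"
proof -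
  have path: "path_map 1 1 {1::nat} Map.empty"
    by (auto simp: path_map_def intro: pinjI)
  have "orbit_count n k = card {\<alpha> \<in> pinj {1..n} {1..n}. Map.empty \<subseteq>\<^sub>m \<alpha> \<and> card (porbit \<alpha> 1) = k}"
    by (simp add: orbit_count_def sym_inv_eq_pinj)
  also have "\<dots> = (\<Prod>i<k - 1. n - 1 - i) * (total_chains (n - k) + 2 * rook_placements (n - k) (n - k))"
    using card_extending_path[OF _ _ _ _ path, of "{1..n}" k "k - 1"] assms by simp
  finally show ?thesis by (simp add: sym_inv_eq_pinj card_pinj)
qed

lemma finite_orbit_sym_inv:
  assumes "\<alpha> \<in> sym_inv n" "x \<in> {1..n}"
  shows "finite ((arrows \<alpha>)\<^sup>* `` {x})"
  using orbit_subset[OF assms(1)[unfolded sym_inv_eq_pinj] assms(2)] by (rule finite_subset) simp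

lemma orbit_count_0:
  assumes "n \<ge> 1"
  shows "orbit_count n 0 = card (nilpotents n)"
proof -
  have "card (porbit \<alpha> 1) = 0 \<longleftrightarrow> \<alpha> 1 = None" if "\<alpha> \<in> sym_inv n" for \<alpha>
    using finite_orbit_sym_inv[OF that, of 1] assms by (auto simp: porbit_eq)
  then have "{\<alpha> \<in> sym_inv n. card (porbit \<alpha> 1) = 0} = {\<alpha> \<in> sym_inv n. \<alpha> 1 = None}" by blast
  then have "orbit_count n 0 = card (pinj ({1..n} - {1}) {1..n})"
    by (simp add: orbit_count_def sym_inv_eq_pinj pinj_undefined_at)
  then show ?thesis
    using assms by (simp add: card_pinj card_nilpotents rook_placements_commute[of n])
qed

lemma orbit_count_1:
  assumes "n \<ge> 1"
  shows "orbit_count n 1 = card (sym_inv (n - 1))"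
proof -
  have "card (porbit \<alpha> 1) = 1 \<longleftrightarrow> \<alpha> 1 = Some 1" if "\<alpha> \<in> sym_inv n" for \<alpha>
  proof
    assume "card (porbit \<alpha> 1) = 1"
    then obtain x where x: "porbit \<alpha> 1 = {x}" by (auto simp: card_1_singleton_iff)
    then obtain y where y: "\<alpha> 1 = Some y" by (auto simp: porbit_eq split: if_splits)
    have "1 \<in> porbit \<alpha> 1" "y \<in> porbit \<alpha> 1" using y by (auto simp: porbit_eq arrows_def)
    then show "\<alpha> 1 = Some 1" using x y by simp
  next
    assume eq: "\<alpha> 1 = Some 1"
    then have "(arrows \<alpha>)\<^sup>* `` {1} \<subseteq> {1}" by (intro orbit_closed) auto
    then have "porbit \<alpha> 1 = {1}" using eq by (auto simp: porbit_eq)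
    then show "card (porbit \<alpha> 1) = 1" by simp
  qed
  then have "{\<alpha> \<in> sym_inv n. card (porbit \<alpha> 1) = 1} = {\<alpha> \<in> sym_inv n. \<alpha> 1 = Some 1}" by blast
  then show ?thesis
    using assms by (simp add: orbit_count_def sym_inv_eq_pinj card_pinj_fixing card_pinj)
qed

lemma falling_fact_of_nat:
  assumes "j \<le> m"
  shows "falling_fact (int m) j = int (\<Prod>i<j. m - i)"
  using assms by (simp add: falling_fact_def)

theorem theorem4:
  fixes n :: nat
  assumes "n \<ge> 1"
  shows "orbit_count n 0 = card (nilpotents n)
    \<and> orbit_count n 1 = card (sym_inv (n - 1))
    \<and> (\<forall>k. 1 < k \<and> k \<le> n \<longrightarrow>
         int (orbit_count n k) =
           falling_fact (int n - 1) (k - 1)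
             * (int (total_chains (n - k)) + 2 * int (card (sym_inv (n - k)))))"
proof (intro conjI allI impI)
  show "orbit_count n 0 = card (nilpotents n)" using assms by (rule orbit_count_0)
  show "orbit_count n 1 = card (sym_inv (n - 1))" using assms by (rule orbit_count_1)
  fix k assume k: "1 < k \<and> k \<le> n"
  have "falling_fact (int (n - 1)) (k - 1) = int (\<Prod>i<k - 1. n - 1 - i)"
    using k by (intro falling_fact_of_nat) linarith
  moreover have "int (n - 1) = int n - 1" using assms by simp
  ultimately have "falling_fact (int n - 1) (k - 1) = int (\<Prod>i<k - 1. n - 1 - i)" by metis
  then show "int (orbit_count n k) =
      falling_fact (int n - 1) (k - 1)
        * (int (total_chains (n - k)) + 2 * int (card (sym_inv (n - k))))"
    using k orbit_count_eq[of k n] by simp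
qed

end
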